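(* Let $I$ be an ideal in $P=\mathbb{Z}[x_1,\dots,x_n]$ such that $P/I$ is a finite $\mathbb{Z}$-algebra, let $\sigma$ be a term ordering on $\mathbb{T}^n$, let $G$ be a minimal strong $\sigma$-Gröbner basis of $I$, and let $\{t_1,\dots,t_k\}=\mathbb{T}^n\setminus L$, where $L=\{m\in\mathrm{LM}_\sigma(I)\mid\mathrm{LC}_\sigma(m)=1\}$. Consider the following instructions. (1) Start with an empty list $U=[\,]$ and $\mathcal{O}=[t_1,\dots,t_k]$. (2) If $\mathcal{O}$ is empty, return the list $U$ and stop. Otherwise, choose a term $t$ in $\mathcal{O}$ and remove it from $\mathcal{O}$. (3) Find the smallest integer $\ell>1$ such that $\ell s\in\mathrm{LM}_\sigma(G)$ for some $s\in\mathbb{T}^n$ with $s\mid t$. If no such integer exists, continue with step (2). (4) Let $c\in\mathbb{Z}^k$ be the coefficient vector representing $\ell t$, and let $d\in\mathbb{Z}^k$ be the coefficient vector representing $\mathrm{NF}_{\sigma,I}(\ell t)$ with respect to $(t_1,\dots,t_k)$. Append $c-d$ to $U$ and continue with step (2). This is an algorithm which computes a list of tuples $U\subseteq\mathbb{Z}^k$ such that $P/I\cong\mathbb{Z}^k/\langle U\rangle$.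
   Context: $\mathbb{T}^n$ is the monoid of terms (power products) in $x_1,\dots,x_n$. For $f\in P\setminus\{0\}$, $\mathrm{LT}_\sigma(f)$ and $\mathrm{LC}_\sigma(f)$ are the leading term and leading coefficient, and $\mathrm{LM}_\sigma(f)=\mathrm{LC}_\sigma(f)\mathrm{LT}_\sigma(f)$; for a set $S\subseteq P$, $\mathrm{LM}_\sigma(S)=\{\mathrm{LM}_\sigma(f)\mid f\in S\setminus\{0\}\}$. A set $G=\{g_1,\dots,g_r\}\subseteq I$ is a strong $\sigma$-Gröbner basis of $I$ if for every $f\in I\setminus\{0\}$ there is an $i$ such that $\mathrm{LM}_\sigma(f)$ is a multiple of $\mathrm{LM}_\sigma(g_i)$; it is minimal if no $\mathrm{LM}_\sigma(g_i)$ is a multiple of $\mathrm{LM}_\sigma(g_j)$ for $j\ne i$. $\mathrm{NF}_{\sigma,I}(f)$ denotes the normal form of $f$ obtained by the Division Algorithm with respect to the strong $\sigma$-Gröbner basis $G$ of $I$; it is a $\mathbb{Z}$-linear combination of $t_1,\dots,t_k$. A finite $\mathbb{Z}$-algebra is a $\mathbb{Z}$-algebra which is a finitely generated $\mathbb{Z}$-module. The isomorphism is one of $\mathbb{Z}$-modules, and $\langle U\rangle$ is the $\mathbb{Z}$-submodule of $\mathbb{Z}^k$ generated by $U$.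
   Formalization: All elements of G are assumed to have positive leading coefficient. Without this the claim fails: for I = (x, 2) and G = {x, −2}, step (3) finds no ℓ, so U is empty and Z^1 is not isomorphic to P/I = Z/2. *)

theory Defs
  imports "Jordan_Normal_Form.VS_Connect" "HOL-Library.Poly_Mapping" "HOL-Algebra.QuotRing"
begin

(* Exponent vectors; the indeterminates are indexed by a finite type 'n, so n = CARD('n).
   The monoid of terms is written additively: the term with exponent vector t is
   Poly_Mapping.single t 1, and s divides t iff t = u + s for some u. *)
type_synonym 'n pp = "'n \<Rightarrow>\<^sub>0 nat"
type_synonym 'n int_mpoly = "'n pp \<Rightarrow>\<^sub>0 int"

section \<open>Modules and algebras\<close>

definition poly_alg :: "(int, 'n::finite int_mpoly) module" where
  "poly_alg = \<lparr>carrier = UNIV, mult = (*), one = 1, zero = 0, add = (+),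
               smult = (\<lambda>c f. of_int c * f)\<rparr>"

(* The first five fields are those of M Quot N. They form a ring when N is an ideal of a ring M;
   for a submodule N of a mere module only zero, add and smult are meaningful.
   The scalar action is a (N + x) = N + a x. *)
definition quot_mod :: "('a, 'b, 'm) module_scheme \<Rightarrow> 'b set \<Rightarrow> ('a, 'b set) module" where
  "quot_mod M N = \<lparr>carrier = a_rcosets\<^bsub>M\<^esub> N, mult = rcoset_mult M N, one = N +>\<^bsub>M\<^esub> \<one>\<^bsub>M\<^esub>,
                   zero = N, add = set_add M,
                   smult = (\<lambda>a X. N <+>\<^bsub>M\<^esub> ((\<lambda>x. a \<odot>\<^bsub>M\<^esub> x) ` X))\<rparr>"

definition finite_Z_algebra :: "(int, 'b, 'm) module_scheme \<Rightarrow> bool" where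
  "finite_Z_algebra A \<longleftrightarrow> algebra class_ring A \<and>
     (\<exists>S. finite S \<and> S \<subseteq> carrier A \<and> LinearCombinations.module.span class_ring A S = carrier A)"

definition Z_module_iso :: "(int, 'b, 'm) module_scheme \<Rightarrow> (int, 'c, 'k) module_scheme \<Rightarrow> bool" where
  "Z_module_iso M N \<longleftrightarrow> (\<exists>\<phi>. \<phi> \<in> LinearCombinations.module_hom class_ring M N \<and> bij_betw \<phi> (carrier M) (carrier N))"

section \<open>Leading monomials and strong Groebner bases\<close>

definition term_ordering :: "'n::finite pp rel \<Rightarrow> bool" where
  "term_ordering \<sigma> \<longleftrightarrow> linear_order \<sigma> \<and> (\<forall>t. (0, t) \<in> \<sigma>) \<and>
     (\<forall>s t u. (s, t) \<in> \<sigma> \<longrightarrow> (u + s, u + t) \<in> \<sigma>)"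

(* LT, LC and LM are meaningful for nonzero polynomials only. *)
definition LT :: "'n::finite pp rel \<Rightarrow> 'n int_mpoly \<Rightarrow> 'n pp" where
  "LT \<sigma> f = (THE t. t \<in> Poly_Mapping.keys f \<and> (\<forall>s\<in>Poly_Mapping.keys f. (s, t) \<in> \<sigma>))"

definition LC :: "'n::finite pp rel \<Rightarrow> 'n int_mpoly \<Rightarrow> int" where
  "LC \<sigma> f = Poly_Mapping.lookup f (LT \<sigma> f)"

definition LM :: "'n::finite pp rel \<Rightarrow> 'n int_mpoly \<Rightarrow> 'n int_mpoly" where
  "LM \<sigma> f = Poly_Mapping.single (LT \<sigma> f) (LC \<sigma> f)"

definition LM_set :: "'n::finite pp rel \<Rightarrow> 'n int_mpoly set \<Rightarrow> 'n int_mpoly set" where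
  "LM_set \<sigma> S = {LM \<sigma> f | f. f \<in> S - {0}}"

definition strong_GB :: "'n::finite pp rel \<Rightarrow> 'n int_mpoly set \<Rightarrow> 'n int_mpoly set \<Rightarrow> bool" where
  "strong_GB \<sigma> I G \<longleftrightarrow> finite G \<and> G \<subseteq> I \<and> 0 \<notin> G \<and>
     (\<forall>f\<in>I - {0}. \<exists>g\<in>G. LM \<sigma> g dvd LM \<sigma> f)"

definition minimal_strong_GB :: "'n::finite pp rel \<Rightarrow> 'n int_mpoly set \<Rightarrow> 'n int_mpoly set \<Rightarrow> bool" where
  "minimal_strong_GB \<sigma> I G \<longleftrightarrow> strong_GB \<sigma> I G \<and>
     (\<forall>g\<in>G. \<forall>h\<in>G. h \<noteq> g \<longrightarrow> \<not> LM \<sigma> h dvd LM \<sigma> g)"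

(* The complement of L in the set of all terms. *)
definition standard_terms :: "'n::finite pp rel \<Rightarrow> 'n int_mpoly set \<Rightarrow> 'n pp set" where
  "standard_terms \<sigma> I =
     {t. Poly_Mapping.single t 1 \<notin> {m \<in> LM_set \<sigma> I. LC \<sigma> m = 1}}"

section \<open>The Division Algorithm\<close>

(* normal_form \<sigma> G f r: the Division Algorithm by G, started with f, can return the remainder r.
   As long as the current polynomial v is nonzero, either LM v is cancelled by a monomial multiple
   of some g in G whose leading monomial divides LM v, or, if there is no such g, LM v is moved to
   the remainder. The choice of g is left open, since over the integers r may depend on it; fixing
   an enumeration of G and always taking the first suitable g is one admissible strategy. *)
inductive normal_form ::
  "'n::finite pp rel \<Rightarrow> 'n int_mpoly set \<Rightarrow> 'n int_mpoly \<Rightarrow> 'n int_mpoly \<Rightarrow> bool"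
  for \<sigma> G where
  finished: "normal_form \<sigma> G 0 0"
| reduce: "\<lbrakk>v \<noteq> 0; g \<in> G; LM \<sigma> v = Poly_Mapping.single u a * LM \<sigma> g;
           normal_form \<sigma> G (v - Poly_Mapping.single u a * g) r\<rbrakk> \<Longrightarrow> normal_form \<sigma> G v r"
| move: "\<lbrakk>v \<noteq> 0; \<not> (\<exists>g\<in>G. LM \<sigma> g dvd LM \<sigma> v); normal_form \<sigma> G (v - LM \<sigma> v) r\<rbrakk>
         \<Longrightarrow> normal_form \<sigma> G v (LM \<sigma> v + r)"

section \<open>The instructions (1) to (4)\<close>

definition coeff_vec_of :: "'n::finite pp list \<Rightarrow> 'n int_mpoly \<Rightarrow> int vec \<Rightarrow> bool" where
  "coeff_vec_of ts f c \<longleftrightarrow> c \<in> carrier_vec (length ts) \<and>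
     f = (\<Sum>i<length ts. Poly_Mapping.single (ts ! i) (c $ i))"

definition step3_cand :: "'n::finite pp rel \<Rightarrow> 'n int_mpoly set \<Rightarrow> 'n pp \<Rightarrow> int \<Rightarrow> bool" where
  "step3_cand \<sigma> G t l \<longleftrightarrow> l > 1 \<and>
     (\<exists>s. (\<exists>u. t = u + s) \<and> Poly_Mapping.single s l \<in> LM_set \<sigma> G)"

(* One pass through steps (2) to (4), on states (O, U). The start state is (ts, []), and (2) stops
   exactly at the states ([], U), with output U.

   Step (3) sees only elements of G with positive leading coefficient. Hence the correctness
   statement assumes the usual normalization that all g in G have positive leading coefficient:
   for I = (x, 2) and G = {x, -2}, the output would be [], but P/I is not isomorphic to Z^1. *)
inductive alg_step ::
  "'n::finite pp rel \<Rightarrow> 'n int_mpoly set \<Rightarrow> 'n pp list \<Rightarrow>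
   'n pp list \<times> int vec list \<Rightarrow> 'n pp list \<times> int vec list \<Rightarrow> bool"
  for \<sigma> G ts where
  skip: "\<lbrakk>t \<in> set Os; \<not> (\<exists>l. step3_cand \<sigma> G t l)\<rbrakk>
         \<Longrightarrow> alg_step \<sigma> G ts (Os, U) (remove1 t Os, U)"
| append: "\<lbrakk>t \<in> set Os; step3_cand \<sigma> G t l; \<forall>l'. step3_cand \<sigma> G t l' \<longrightarrow> l \<le> l';
            coeff_vec_of ts (Poly_Mapping.single t l) c;
            normal_form \<sigma> G (Poly_Mapping.single t l) r; coeff_vec_of ts r d\<rbrakk>
         \<Longrightarrow> alg_step \<sigma> G ts (Os, U) (remove1 t Os, U @ [c - d])"

end

theory Submission
  imports Defs "Jordan_Normal_Form.Char_Poly"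
begin

text \<open>
  The map \<open>\<int>\<^sup>k \<rightarrow> P/I\<close> that sends \<open>c\<close> to the class of \<open>c\<^sub>1 t\<^sub>1 + \<dots> + c\<^sub>k t\<^sub>k\<close> is onto, because the Division
  Algorithm rewrites every polynomial modulo \<open>I\<close> as an integer combination of standard terms
  (\<open>normal_form_exists\<close>, \<open>normal_form_standard\<close>). So \<open>P/I\<close> is \<open>\<int>\<^sup>k\<close> modulo the relations among the
  standard terms, and the point is that the vectors collected in \<open>U\<close> generate these relations.

  The vector appended for \<open>t\<close> represents \<open>l t - NF(l t)\<close>, an element of \<open>I\<close> with leading monomial
  \<open>l t\<close>. Conversely, let \<open>f \<noteq> 0\<close> in \<open>I\<close> be supported on standard terms, with leading term \<open>t\<close>. The
  leading coefficients that occur in \<open>I\<close> at \<open>t\<close> form with 0 an ideal of the integers. As the basis is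
  strong, step (3) finds the generator of that ideal (\<open>least_step3_cand_dvd\<close>); positivity of the
  leading coefficients in \<open>G\<close> rules out that only the negative generator is present. Hence \<open>l\<close> divides
  the leading coefficient of \<open>f\<close>, and subtracting a multiple of \<open>l t - NF(l t)\<close> leaves an element of
  the same kind with a smaller leading term. Term orderings are well-founded by Dickson's lemma, so
  this process ends at 0 (\<open>kernel_subset_span\<close>).

  There are finitely many standard terms because each indeterminate is integral over \<open>\<int>\<close> modulo \<open>I\<close>:
  a monic polynomial in it lies in \<open>I\<close> (\<open>monic_poly_in_ideal\<close>), so one of its powers is a leading
  monomial with coefficient 1, which bounds its exponent in the standard terms.
\<close>

section \<open>Dickson's lemma and monomial multiples\<close>

text \<open>Dickson's lemma is proved by thinning out a sequence of exponent vectors, one coordinate at a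
  time, until it is nondecreasing in every coordinate.\<close>

lemma nat_seq_mono_subseq:
  fixes g :: "nat \<Rightarrow> nat"
  obtains r :: "nat \<Rightarrow> nat" where "strict_mono r" "mono (\<lambda>i. g (r i))"
proof -
  obtain r where r: "strict_mono r" "monoseq (\<lambda>i. g (r i))"
    using seq_monosub by blast
  show ?thesis
  proof (cases "mono (\<lambda>i. g (r i))")
    case True
    with r that show ?thesis by blast
  next
    case False
    with r(2) have dec: "\<And>i j. i \<le> j \<Longrightarrow> g (r j) \<le> g (r i)"
      unfolding monoseq_def mono_def by blast
    define m where "m = (LEAST m. \<exists>i. g (r i) = m)"
    have "\<exists>i. g (r i) = m"
      unfolding m_def by (rule LeastI_ex) auto
    then obtain N where N: "g (r N) = m" by blast
    have "m \<le> g (r i)" for i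
      unfolding m_def by (rule Least_le) auto
    then have const: "g (r (N + i)) = m" for i
      using dec[of N "N + i"] N by (simp add: antisym)
    have "strict_mono (\<lambda>i. r (N + i))"
      using r(1) by (simp add: strict_mono_def)
    moreover have "mono (\<lambda>i. g (r (N + i)))"
      by (simp add: const mono_def)
    ultimately show ?thesis by (rule that)
  qed
qed

lemma simultaneous_mono_subseq:
  fixes f :: "nat \<Rightarrow> 'a \<Rightarrow> nat"
  assumes "finite A"
  shows "\<exists>r :: nat \<Rightarrow> nat. strict_mono r \<and> (\<forall>x\<in>A. mono (\<lambda>i. f (r i) x))"
  using assms
proof induction
  case empty
  show ?case by (rule exI[of _ id]) (simp add: strict_mono_def)
next
  case (insert x A)
  then obtain r :: "nat \<Rightarrow> nat" where r: "strict_mono r" "\<forall>y\<in>A. mono (\<lambda>i. f (r i) y)" by blast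
  obtain q :: "nat \<Rightarrow> nat" where q: "strict_mono q" "mono (\<lambda>i. f (r (q i)) x)"
    by (rule nat_seq_mono_subseq)
  have "mono (\<lambda>i. f (r (q i)) y)" if "y \<in> A" for y
    using r(2) that q(1) by (simp add: mono_def strict_mono_less_eq)
  moreover have "strict_mono (\<lambda>i. r (q i))"
    using r(1) q(1) by (simp add: strict_mono_def)
  ultimately show ?case
    using q(2) by (intro exI[of _ "\<lambda>i. r (q i)"]) auto
qed

lemma dickson:
  fixes f :: "nat \<Rightarrow> 'n::finite pp"
  obtains i j u where "i < j" "f j = f i + u"
proof -
  obtain r :: "nat \<Rightarrow> nat" where r: "strict_mono r" "\<And>x. mono (\<lambda>i. Poly_Mapping.lookup (f (r i)) x)"
    using simultaneous_mono_subseq[of "UNIV :: 'n set" "\<lambda>i. Poly_Mapping.lookup (f i)"] by auto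
  have "f (r 1) = f (r 0) + (f (r 1) - f (r 0))"
    by (rule poly_mapping_eqI)
      (use r(2) in \<open>simp add: lookup_add lookup_minus mono_def\<close>)
  moreover have "r 0 < r 1"
    using r(1) by (simp add: strict_mono_def)
  ultimately show ?thesis using that by blast
qed

lemma lookup_single_mult:
  fixes f :: "'n int_mpoly"
  shows "Poly_Mapping.lookup (Poly_Mapping.single u a * f) (u + t) = a * Poly_Mapping.lookup f t"
  by (simp add: lookup_mult lookup_single when_mult)

lemma lookup_single_mult_eq_0:
  fixes f :: "'n int_mpoly"
  assumes "\<nexists>s. t = u + s"
  shows "Poly_Mapping.lookup (Poly_Mapping.single u a * f) t = 0"
  using assms by (simp add: lookup_mult lookup_single when_mult)

lemma keys_single_mult:
  fixes f :: "'n int_mpoly"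
  assumes "a \<noteq> 0"
  shows "Poly_Mapping.keys (Poly_Mapping.single u a * f) = (+) u ` Poly_Mapping.keys f"
proof (intro equalityI subsetI)
  fix t assume t: "t \<in> Poly_Mapping.keys (Poly_Mapping.single u a * f)"
  then obtain s where "t = u + s"
    using lookup_single_mult_eq_0[of t u a f] by (auto simp: in_keys_iff)
  with t assms show "t \<in> (+) u ` Poly_Mapping.keys f"
    by (auto simp: in_keys_iff lookup_single_mult)
next
  fix t assume "t \<in> (+) u ` Poly_Mapping.keys f"
  with assms show "t \<in> Poly_Mapping.keys (Poly_Mapping.single u a * f)"
    by (auto simp: in_keys_iff lookup_single_mult)
qed

lemma single_dvd_singleE:
  fixes b :: int and s t :: "'n pp"
  assumes "Poly_Mapping.single s a dvd Poly_Mapping.single t b" and "b \<noteq> 0"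
  obtains u c where "t = u + s" "b = c * a"
proof -
  from assms(1) obtain k where k: "Poly_Mapping.single t b = Poly_Mapping.single s a * k"
    by (auto simp: dvd_def)
  have b: "b = Poly_Mapping.lookup (Poly_Mapping.single s a * k) t"
    by (simp flip: k)
  with assms(2) obtain u where u: "t = s + u"
    using lookup_single_mult_eq_0[of t s a k] by metis
  show ?thesis
  proof (rule that)
    show "t = u + s" using u by (simp add: add.commute)
    show "b = Poly_Mapping.lookup k u * a" using b u by (simp add: lookup_single_mult)
  qed
qed

section \<open>Term orderings and leading terms\<close>

locale monomial_order =
  fixes \<sigma> :: "'n::finite pp rel"
  assumes term_ordering: "term_ordering \<sigma>"
begin

abbreviation le :: "'n pp \<Rightarrow> 'n pp \<Rightarrow> bool" (infix "\<preceq>" 50)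
  where "s \<preceq> t \<equiv> (s, t) \<in> \<sigma>"

abbreviation lt :: "'n pp \<Rightarrow> 'n pp \<Rightarrow> bool" (infix "\<prec>" 50)
  where "s \<prec> t \<equiv> s \<preceq> t \<and> s \<noteq> t"

lemma le_refl [simp]: "t \<preceq> t"
  using term_ordering
  by (auto simp: term_ordering_def linear_order_on_def partial_order_on_def
      preorder_on_def refl_on_def)

lemma le_trans [trans]: "r \<preceq> s \<Longrightarrow> s \<preceq> t \<Longrightarrow> r \<preceq> t"
  using term_ordering
  by (auto simp: term_ordering_def linear_order_on_def partial_order_on_def
      preorder_on_def dest: transD)

lemma le_antisym: "s \<preceq> t \<Longrightarrow> t \<preceq> s \<Longrightarrow> s = t"
  using term_ordering
  by (auto simp: term_ordering_def linear_order_on_def partial_order_on_def dest: antisymD)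

lemma le_total: "s \<preceq> t \<or> t \<preceq> s"
  using term_ordering le_refl
  by (cases "s = t") (auto simp: term_ordering_def linear_order_on_def total_on_def)

lemma add_le_mono: "s \<preceq> t \<Longrightarrow> u + s \<preceq> u + t"
  using term_ordering by (auto simp: term_ordering_def)

lemma le_add: "s \<preceq> s + u"
  using add_le_mono[of 0 u s] term_ordering by (auto simp: term_ordering_def)

lemma lt_trans: "r \<prec> s \<Longrightarrow> s \<prec> t \<Longrightarrow> r \<prec> t"
  using le_trans le_antisym by blast

text \<open>Compatibility with multiplication and minimality of 1 make \<open>\<sigma>\<close> extend divisibility, so a
  descending chain would be a sequence none of whose members divides a later one, against
  Dickson's lemma.\<close>

lemma wf_lt: "wf {(s, t). s \<prec> t}"
  unfolding wf_iff_no_infinite_down_chain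
proof safe
  fix f assume "\<forall>i. (f (Suc i), f i) \<in> {(s, t). s \<prec> t}"
  then have step: "f (Suc i) \<prec> f i" for i by auto
  have less: "f j \<prec> f i" if "i < j" for i j
    using that by (induction rule: less_Suc_induct) (use step lt_trans in blast)+
  obtain i j u where ij: "i < j" "f j = f i + u" by (rule dickson)
  from less[OF ij(1)] le_add[of "f i" u] show False
    unfolding ij(2) using le_antisym by blast
qed

lemma LT_eqI:
  assumes "t \<in> Poly_Mapping.keys f" and "\<And>s. s \<in> Poly_Mapping.keys f \<Longrightarrow> s \<preceq> t"
  shows "LT \<sigma> f = t"
  unfolding LT_def using assms le_antisym by (intro the_equality) blast+

lemma LT_in_keys_and_max:
  assumes "f \<noteq> 0"
  shows "LT \<sigma> f \<in> Poly_Mapping.keys f \<and> (\<forall>s\<in>Poly_Mapping.keys f. s \<preceq> LT \<sigma> f)"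
proof -
  have "\<exists>t\<in>K. \<forall>s\<in>K. s \<preceq> t" if "finite K" "K \<noteq> {}" for K
    using that
  proof (induction rule: finite_ne_induct)
    case (insert x K)
    then obtain t where "t \<in> K" "\<forall>s\<in>K. s \<preceq> t" by blast
    with le_total[of x t] show ?case
      by (metis insert_iff le_refl le_trans)
  qed simp
  from this[of "Poly_Mapping.keys f"] assms
  obtain t where "t \<in> Poly_Mapping.keys f" "\<forall>s\<in>Poly_Mapping.keys f. s \<preceq> t"
    by auto
  with LT_eqI[of t f] show ?thesis by auto
qed

lemma LT_in_keys: "f \<noteq> 0 \<Longrightarrow> LT \<sigma> f \<in> Poly_Mapping.keys f"
  by (simp add: LT_in_keys_and_max)

lemma LT_max: "s \<in> Poly_Mapping.keys f \<Longrightarrow> s \<preceq> LT \<sigma> f"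
  using LT_in_keys_and_max[of f] by (cases "f = 0") auto

lemma LC_neq_0: "f \<noteq> 0 \<Longrightarrow> LC \<sigma> f \<noteq> 0"
  using LT_in_keys by (simp add: LC_def in_keys_iff)

lemma LT_single [simp]: "b \<noteq> 0 \<Longrightarrow> LT \<sigma> (Poly_Mapping.single t b) = t"
  by (rule LT_eqI) auto

lemma LC_single [simp]: "b \<noteq> 0 \<Longrightarrow> LC \<sigma> (Poly_Mapping.single t b) = b"
  by (simp add: LC_def)

lemma LM_single [simp]: "b \<noteq> 0 \<Longrightarrow> LM \<sigma> (Poly_Mapping.single t b) = Poly_Mapping.single t b"
  by (simp add: LM_def)

lemma LT_single_mult:
  assumes "f \<noteq> 0" "a \<noteq> 0"
  shows "LT \<sigma> (Poly_Mapping.single u a * f) = u + LT \<sigma> f"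
  using assms LT_in_keys[of f] LT_max[of _ f]
  by (intro LT_eqI) (auto simp: keys_single_mult intro: add_le_mono)

lemma LC_single_mult:
  assumes "f \<noteq> 0" "a \<noteq> 0"
  shows "LC \<sigma> (Poly_Mapping.single u a * f) = a * LC \<sigma> f"
  using assms by (simp add: LC_def LT_single_mult lookup_single_mult)

lemma LM_single_mult:
  assumes "f \<noteq> 0" "a \<noteq> 0"
  shows "LM \<sigma> (Poly_Mapping.single u a * f) = Poly_Mapping.single u a * LM \<sigma> f"
  using assms by (simp add: LM_def LT_single_mult LC_single_mult mult_single)

text \<open>The cancellation behind every reduction step, whence its termination.\<close>

lemma keys_diff_below_LT:
  assumes "f \<noteq> 0" "g \<noteq> 0" "LM \<sigma> f = LM \<sigma> g" "s \<in> Poly_Mapping.keys (f - g)"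
  shows "s \<prec> LT \<sigma> f"
proof -
  have eq: "LT \<sigma> f = LT \<sigma> g" "LC \<sigma> f = LC \<sigma> g"
    using LC_neq_0[of f] LC_neq_0[of g] arg_cong[OF assms(3), of "LT \<sigma>"]
      arg_cong[OF assms(3), of "LC \<sigma>"] assms(1,2)
    by (simp_all add: LM_def)
  then have "Poly_Mapping.lookup (f - g) (LT \<sigma> f) = 0"
    by (simp add: lookup_minus LC_def)
  with assms(4) have "s \<noteq> LT \<sigma> f" by (auto simp: in_keys_iff)
  moreover have "s \<in> Poly_Mapping.keys f \<or> s \<in> Poly_Mapping.keys g"
    using assms(4) by (auto simp: in_keys_iff lookup_minus)
  ultimately show ?thesis
    using LT_max[of s f] LT_max[of s g] eq by auto
qed

lemma LM_in_LM_set_iff: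
  assumes "c \<noteq> 0"
  shows "Poly_Mapping.single t c \<in> LM_set \<sigma> S \<longleftrightarrow>
    (\<exists>f\<in>S. f \<noteq> 0 \<and> LT \<sigma> f = t \<and> LC \<sigma> f = c)"
proof
  assume "Poly_Mapping.single t c \<in> LM_set \<sigma> S"
  then obtain f where f: "f \<in> S" "f \<noteq> 0" "Poly_Mapping.single t c = LM \<sigma> f"
    by (auto simp: LM_set_def)
  from LC_neq_0[OF f(2)] arg_cong[OF f(3), of "LT \<sigma>"] arg_cong[OF f(3), of "LC \<sigma>"] assms
  have "LT \<sigma> f = t" "LC \<sigma> f = c" by (simp_all add: LM_def)
  with f show "\<exists>f\<in>S. f \<noteq> 0 \<and> LT \<sigma> f = t \<and> LC \<sigma> f = c" by blast
next
  assume "\<exists>f\<in>S. f \<noteq> 0 \<and> LT \<sigma> f = t \<and> LC \<sigma> f = c"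
  then show "Poly_Mapping.single t c \<in> LM_set \<sigma> S"
    by (auto simp: LM_set_def LM_def)
qed

lemma standard_terms_iff:
  "t \<in> standard_terms \<sigma> I \<longleftrightarrow> \<not> (\<exists>f\<in>I. f \<noteq> 0 \<and> LT \<sigma> f = t \<and> LC \<sigma> f = 1)"
  by (simp add: standard_terms_def LM_in_LM_set_iff)

end

section \<open>Ideals of the polynomial ring\<close>

lemma
  assumes "ideal I poly_alg"
  shows ideal_zero: "0 \<in> I"
    and ideal_add: "\<And>f g. f \<in> I \<Longrightarrow> g \<in> I \<Longrightarrow> f + g \<in> I"
    and ideal_mult: "\<And>f h. f \<in> I \<Longrightarrow> h * f \<in> I"
proof -
  interpret ideal I poly_alg by fact
  show "0 \<in> I" using additive_subgroup.zero_closed[OF is_additive_subgroup] by (simp add: poly_alg_def)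
  show "f + g \<in> I" if "f \<in> I" "g \<in> I" for f g
    using additive_subgroup.a_closed[OF is_additive_subgroup that] by (simp add: poly_alg_def)
  show "h * f \<in> I" if "f \<in> I" for f h
    using I_l_closed[OF that, of h] by (simp add: poly_alg_def)
qed

lemma ideal_diff:
  assumes "ideal I poly_alg" "f \<in> I" "g \<in> I"
  shows "f - g \<in> I"
  using ideal_add[OF assms(1,2) ideal_mult[OF assms(1,3), of "-1"]] by simp

lemma ideal_sum:
  assumes "ideal I poly_alg" "\<And>x. x \<in> A \<Longrightarrow> F x \<in> I"
  shows "sum F A \<in> I"
  using assms(2)
  by (induction A rule: infinite_finite_induct)
    (simp_all add: ideal_zero[OF assms(1)] ideal_add[OF assms(1)])

section \<open>The Division Algorithm\<close>

locale strong_groebner_basis = monomial_order \<sigma>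
  for \<sigma> :: "'n::finite pp rel" +
  fixes I G :: "'n int_mpoly set"
  assumes ideal: "ideal I poly_alg"
    and strong_GB: "strong_GB \<sigma> I G"
begin

lemma G_subset: "g \<in> G \<Longrightarrow> g \<in> I" and G_nonzero: "g \<in> G \<Longrightarrow> g \<noteq> 0"
  using strong_GB by (auto simp: strong_GB_def)

lemma LM_dvd_LME:
  assumes "g \<in> G" "f \<noteq> 0" "LM \<sigma> g dvd LM \<sigma> f"
  obtains u a where "LT \<sigma> f = u + LT \<sigma> g" "LC \<sigma> f = a * LC \<sigma> g" "a \<noteq> 0"
    "LM \<sigma> f = Poly_Mapping.single u a * LM \<sigma> g"
proof -
  obtain u a where ua: "LT \<sigma> f = u + LT \<sigma> g" "LC \<sigma> f = a * LC \<sigma> g"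
    using assms(3) LC_neq_0[OF assms(2)] unfolding LM_def by (rule single_dvd_singleE)
  moreover have "a \<noteq> 0" using ua(2) LC_neq_0[OF assms(2)] by auto
  moreover have "LM \<sigma> f = Poly_Mapping.single u a * LM \<sigma> g"
    by (simp add: LM_def mult_single ua)
  ultimately show ?thesis by (rule that)
qed

lemma ideal_LME:
  assumes "f \<in> I" "f \<noteq> 0"
  obtains g u a where "g \<in> G" "LT \<sigma> f = u + LT \<sigma> g" "LC \<sigma> f = a * LC \<sigma> g"
proof -
  obtain g where g: "g \<in> G" "LM \<sigma> g dvd LM \<sigma> f"
    using strong_GB assms by (auto simp: strong_GB_def)
  then show ?thesis using LM_dvd_LME[OF g(1) assms(2) g(2)] that by metis
qed

lemma reduce_below_LT:
  assumes "v \<noteq> 0" "g \<in> G" "LM \<sigma> v = Poly_Mapping.single u a * LM \<sigma> g"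
    and "s \<in> Poly_Mapping.keys (v - Poly_Mapping.single u a * g)"
  shows "s \<prec> LT \<sigma> v"
proof -
  have "LM \<sigma> v \<noteq> 0"
    using LC_neq_0[OF assms(1)] by (metis LM_def lookup_single_eq lookup_zero)
  then have a: "a \<noteq> 0" using assms(3) by auto
  have g: "g \<noteq> 0" using G_nonzero assms(2) .
  have "Poly_Mapping.single u a * g \<noteq> 0"
    using keys_single_mult[OF a, of u g] g by auto
  then show ?thesis
    using keys_diff_below_LT[OF assms(1) _ _ assms(4)] assms(3) LM_single_mult[OF g a] by simp
qed

lemma move_below_LT:
  assumes "v \<noteq> 0" "s \<in> Poly_Mapping.keys (v - LM \<sigma> v)"
  shows "s \<prec> LT \<sigma> v"
proof (rule keys_diff_below_LT[OF assms(1) _ _ assms(2)])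
  show "LM \<sigma> v \<noteq> 0"
    using LC_neq_0[OF assms(1)] by (metis LM_def lookup_single_eq lookup_zero)
  show "LM \<sigma> v = LM \<sigma> (LM \<sigma> v)"
    using LC_neq_0[OF assms(1)] by (simp add: LM_def)
qed

text \<open>Each step of the Division Algorithm strictly lowers the leading term of the current polynomial
  and \<open>\<prec>\<close> is well-founded.\<close>

lemma normal_form_exists: "\<exists>r. normal_form \<sigma> G v r"
proof -
  have nonzero: "\<exists>r. normal_form \<sigma> G v r" if "v \<noteq> 0" "LT \<sigma> v = t" for v t
    using wf_lt that
  proof (induction t arbitrary: v rule: wf_induct_rule)
    case (less t)
    have IH: "\<exists>r. normal_form \<sigma> G w r" if "\<And>s. s \<in> Poly_Mapping.keys w \<Longrightarrow> s \<prec> t" for w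
    proof (cases "w = 0")
      case False
      then have "LT \<sigma> w \<prec> t" using that LT_in_keys by blast
      with less.IH False show ?thesis by blast
    qed (use normal_form.finished in blast)
    show ?case
    proof (cases "\<exists>g\<in>G. LM \<sigma> g dvd LM \<sigma> v")
      case True
      then obtain g where g: "g \<in> G" "LM \<sigma> g dvd LM \<sigma> v" by blast
      obtain u a where ua: "LM \<sigma> v = Poly_Mapping.single u a * LM \<sigma> g"
        using LM_dvd_LME[OF g(1) less.prems(1) g(2)] by metis
      from reduce_below_LT[OF less.prems(1) g(1) ua] less.prems(2)
      have "\<exists>r. normal_form \<sigma> G (v - Poly_Mapping.single u a * g) r"
        by (intro IH) blast
      with less.prems(1) g(1) ua show ?thesis by (blast intro: normal_form.reduce)
    next
      case False
      from move_below_LT[OF less.prems(1)] less.prems(2)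
      have "\<exists>r. normal_form \<sigma> G (v - LM \<sigma> v) r"
        by (intro IH) blast
      with less.prems(1) False show ?thesis by (blast intro: normal_form.move)
    qed
  qed
  show ?thesis
    using nonzero normal_form.finished by (cases "v = 0") blast+
qed

lemma normal_form_cong: "normal_form \<sigma> G v r \<Longrightarrow> v - r \<in> I"
proof (induction rule: normal_form.induct)
  case finished
  show ?case using ideal_zero[OF ideal] by simp
next
  case (reduce v g u a r)
  have "Poly_Mapping.single u a * g \<in> I"
    using G_subset reduce.hyps by (simp add: ideal_mult[OF ideal])
  from ideal_add[OF ideal reduce.IH this] show ?case by (simp add: algebra_simps)
next
  case (move v r)
  then show ?case by (simp add: algebra_simps)
qed

text \<open>Only leading monomials that no \<open>LM \<sigma> g\<close> divides are moved to the remainder. Over a term outside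
  \<open>standard_terms \<sigma> I\<close> there is no such monomial: the term itself is a leading monomial of \<open>I\<close>, so it
  is a multiple of some \<open>LM \<sigma> g\<close>, and then so are all its integer multiples.\<close>

lemma normal_form_standard:
  "normal_form \<sigma> G v r \<Longrightarrow> Poly_Mapping.keys r \<subseteq> standard_terms \<sigma> I"
proof (induction rule: normal_form.induct)
  case (move v r)
  have "LT \<sigma> v \<in> standard_terms \<sigma> I"
    unfolding standard_terms_iff
  proof
    assume "\<exists>f\<in>I. f \<noteq> 0 \<and> LT \<sigma> f = LT \<sigma> v \<and> LC \<sigma> f = 1"
    then obtain f where f: "f \<in> I" "f \<noteq> 0" "LT \<sigma> f = LT \<sigma> v" "LC \<sigma> f = 1" by blast
    then obtain g where "g \<in> G" "LM \<sigma> g dvd LM \<sigma> f"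
      using strong_GB by (auto simp: strong_GB_def)
    moreover have "LM \<sigma> f dvd LM \<sigma> v"
      using f(3,4) mult_single[of "LT \<sigma> v" 1 0 "LC \<sigma> v"] by (metis LM_def add.right_neutral dvd_triv_left mult_1)
    ultimately show False using move.hyps(2) dvd_trans by blast
  qed
  then have "Poly_Mapping.keys (LM \<sigma> v) \<subseteq> standard_terms \<sigma> I"
    by (simp add: LM_def)
  with move.IH show ?case
    using keys_add[of "LM \<sigma> v" r] by blast
qed simp_all

lemma normal_form_below:
  assumes "normal_form \<sigma> G v r" "\<And>s. s \<in> Poly_Mapping.keys v \<Longrightarrow> s \<prec> t"
    and "s \<in> Poly_Mapping.keys r"
  shows "s \<prec> t"
  using assms
proof (induction arbitrary: s rule: normal_form.induct)
  case (reduce v g u a r)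
  have "LT \<sigma> v \<prec> t" using reduce.prems(1) reduce.hyps(1) LT_in_keys by blast
  with reduce_below_LT[OF reduce.hyps(1-3)] lt_trans reduce.IH reduce.prems(2)
  show ?case by blast
next
  case (move v r)
  have v: "LT \<sigma> v \<prec> t" using move.prems(1) move.hyps(1) LT_in_keys by blast
  have "s \<in> Poly_Mapping.keys (LM \<sigma> v) \<or> s \<in> Poly_Mapping.keys r"
    using move.prems(2) keys_add[of "LM \<sigma> v" r] by blast
  then show ?case
  proof
    assume "s \<in> Poly_Mapping.keys (LM \<sigma> v)"
    with v show ?thesis by (simp add: LM_def split: if_splits)
  next
    assume "s \<in> Poly_Mapping.keys r"
    with move_below_LT[OF move.hyps(1)] lt_trans v move.IH show ?thesis by blast
  qed
qed simp

text \<open>When the first step is a reduction, the leading term itself never reaches the remainder. In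
  step (4) this makes \<open>l t\<close> the leading monomial of \<open>l t - NF(l t)\<close>.\<close>

lemma normal_form_reducible_below:
  assumes "normal_form \<sigma> G v r" "g \<in> G" "LM \<sigma> g dvd LM \<sigma> v" "v \<noteq> 0"
    and "s \<in> Poly_Mapping.keys r"
  shows "s \<prec> LT \<sigma> v"
  using assms(1)
proof cases
  case (reduce g u a)
  from normal_form_below[OF reduce(4) reduce_below_LT[OF reduce(1-3)] assms(5)]
  show ?thesis .
qed (use assms in auto)

end

section \<open>Quotient modules\<close>

lemma (in Module.module) submodule_imp_abelian_subgroup:
  assumes "LinearCombinations.submodule R N M"
  shows "abelian_subgroup N M"
proof (rule abelian_subgroupI3)
  interpret N: LinearCombinations.submodule R N M by fact
  show "additive_subgroup N M"
  proof (intro additive_subgroup.intro subgroup.intro)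
    fix v assume v: "v \<in> N"
    then have "\<ominus>\<^bsub>R\<^esub> \<one>\<^bsub>R\<^esub> \<odot>\<^bsub>M\<^esub> v = \<ominus>\<^bsub>M\<^esub> v"
      using N.subset by (auto simp: smult_l_minus)
    then show "inv\<^bsub>add_monoid M\<^esub> v \<in> N"
      using N.smult_closed[OF _ v, of "\<ominus>\<^bsub>R\<^esub> \<one>\<^bsub>R\<^esub>"] by (simp add: a_inv_def)
  qed (use N.subset in auto)
  show "abelian_group M" by (rule M.abelian_group_axioms)
qed

lemma carrier_quot_mod: "carrier (quot_mod M N) = (\<lambda>x. N +>\<^bsub>M\<^esub> x) ` carrier M"
  unfolding quot_mod_def A_RCOSETS_def' by (simp add: UNION_singleton_eq_range)

lemma (in Module.module)
  assumes N: "LinearCombinations.submodule R N M"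
  shows quot_mod_eq_iff: "\<And>x y. x \<in> carrier M \<Longrightarrow> y \<in> carrier M \<Longrightarrow>
      N +>\<^bsub>M\<^esub> x = N +>\<^bsub>M\<^esub> y \<longleftrightarrow> x \<ominus>\<^bsub>M\<^esub> y \<in> N"
    and quot_mod_add: "\<And>x y. x \<in> carrier M \<Longrightarrow> y \<in> carrier M \<Longrightarrow>
      (N +>\<^bsub>M\<^esub> x) \<oplus>\<^bsub>quot_mod M N\<^esub> (N +>\<^bsub>M\<^esub> y) = N +>\<^bsub>M\<^esub> (x \<oplus>\<^bsub>M\<^esub> y)"
    and quot_mod_smult: "\<And>a x. a \<in> carrier R \<Longrightarrow> x \<in> carrier M \<Longrightarrow>
      a \<odot>\<^bsub>quot_mod M N\<^esub> (N +>\<^bsub>M\<^esub> x) = N +>\<^bsub>M\<^esub> (a \<odot>\<^bsub>M\<^esub> x)"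
proof -
  interpret N: LinearCombinations.submodule R N M by fact
  interpret S: abelian_subgroup N M
    using N by (rule submodule_imp_abelian_subgroup)
  note N_carrier = subsetD[OF N.subset]
  show "N +>\<^bsub>M\<^esub> x = N +>\<^bsub>M\<^esub> y \<longleftrightarrow> x \<ominus>\<^bsub>M\<^esub> y \<in> N"
    if "x \<in> carrier M" "y \<in> carrier M" for x y
  proof -
    have "N +>\<^bsub>M\<^esub> x = N +>\<^bsub>M\<^esub> y \<longleftrightarrow> x \<in> N +>\<^bsub>M\<^esub> y"
      using S.a_repr_independence'[OF _ that(2), of x] S.a_repr_independenceD[OF that(1), of y]
      by metis
    also have "\<dots> \<longleftrightarrow> x \<ominus>\<^bsub>M\<^esub> y \<in> N"
      using S.a_rcos_module[OF that(2,1)] unfolding a_minus_def .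
    finally show ?thesis .
  qed
  show "(N +>\<^bsub>M\<^esub> x) \<oplus>\<^bsub>quot_mod M N\<^esub> (N +>\<^bsub>M\<^esub> y) = N +>\<^bsub>M\<^esub> (x \<oplus>\<^bsub>M\<^esub> y)"
    if "x \<in> carrier M" "y \<in> carrier M" for x y
    using S.a_rcos_sum[OF that] by (simp add: quot_mod_def)
  show "a \<odot>\<^bsub>quot_mod M N\<^esub> (N +>\<^bsub>M\<^esub> x) = N +>\<^bsub>M\<^esub> (a \<odot>\<^bsub>M\<^esub> x)"
    if a: "a \<in> carrier R" and x: "x \<in> carrier M" for a x
  proof -
    have "n \<oplus>\<^bsub>M\<^esub> a \<odot>\<^bsub>M\<^esub> (m \<oplus>\<^bsub>M\<^esub> x) = (n \<oplus>\<^bsub>M\<^esub> a \<odot>\<^bsub>M\<^esub> m) \<oplus>\<^bsub>M\<^esub> a \<odot>\<^bsub>M\<^esub> x"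
      if "n \<in> N" "m \<in> N" for n m
      using that N_carrier a x by (simp add: smult_r_distr M.a_assoc)
    then have "\<exists>k\<in>N. n \<oplus>\<^bsub>M\<^esub> a \<odot>\<^bsub>M\<^esub> (m \<oplus>\<^bsub>M\<^esub> x) = k \<oplus>\<^bsub>M\<^esub> a \<odot>\<^bsub>M\<^esub> x"
      if "n \<in> N" "m \<in> N" for n m
      using that N.m_closed N.smult_closed[OF a] by blast
    then have "N <+>\<^bsub>M\<^esub> ((\<odot>\<^bsub>M\<^esub>) a ` (N +>\<^bsub>M\<^esub> x)) \<subseteq> N +>\<^bsub>M\<^esub> (a \<odot>\<^bsub>M\<^esub> x)"
      unfolding set_add_def' a_r_coset_def' by blast
    moreover have "n \<oplus>\<^bsub>M\<^esub> a \<odot>\<^bsub>M\<^esub> x = n \<oplus>\<^bsub>M\<^esub> a \<odot>\<^bsub>M\<^esub> (\<zero>\<^bsub>M\<^esub> \<oplus>\<^bsub>M\<^esub> x)" for n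
      using x by simp
    then have "N +>\<^bsub>M\<^esub> (a \<odot>\<^bsub>M\<^esub> x) \<subseteq> N <+>\<^bsub>M\<^esub> ((\<odot>\<^bsub>M\<^esub>) a ` (N +>\<^bsub>M\<^esub> x))"
      unfolding set_add_def' a_r_coset_def' using N.zero_closed by blast
    ultimately show ?thesis by (simp add: quot_mod_def)
  qed
qed

text \<open>The first isomorphism theorem, for \<open>h\<close> followed by the projection to \<open>A\<close> modulo \<open>NA\<close>, stated in
  the direction from \<open>A\<close> to \<open>B\<close>.\<close>

lemma Z_module_iso_quotI:
  fixes A :: "(int, 'b, 'm) module_scheme" and B :: "(int, 'c, 'k) module_scheme"
  assumes A: "Module.module class_ring A" and B: "Module.module class_ring B"
    and NA: "LinearCombinations.submodule class_ring NA A"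
    and NB: "LinearCombinations.submodule class_ring NB B"
    and h: "h \<in> LinearCombinations.module_hom class_ring B A"
    and surj: "\<And>x. x \<in> carrier A \<Longrightarrow> \<exists>y\<in>carrier B. x \<ominus>\<^bsub>A\<^esub> h y \<in> NA"
    and ker: "\<And>y. y \<in> carrier B \<Longrightarrow> h y \<in> NA \<longleftrightarrow> y \<in> NB"
  shows "Z_module_iso (quot_mod A NA) (quot_mod B NB)"
proof -
  interpret A: Module.module class_ring A by (rule A)
  interpret B: Module.module class_ring B by (rule B)
  interpret h: mod_hom class_ring B A h
    by (intro mod_hom.intro A B mod_hom_axioms.intro h)
  let ?qA = "\<lambda>x. NA +>\<^bsub>A\<^esub> x" and ?qB = "\<lambda>y. NB +>\<^bsub>B\<^esub> y"
  have qA_carrier: "carrier (quot_mod A NA) = (\<lambda>y. ?qA (h y)) ` carrier B"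
    unfolding carrier_quot_mod
  proof (intro equalityI image_subsetI)
    fix x assume x: "x \<in> carrier A"
    then obtain y where y: "y \<in> carrier B" "x \<ominus>\<^bsub>A\<^esub> h y \<in> NA" using surj by blast
    then have "?qA x = ?qA (h y)" using A.quot_mod_eq_iff[OF NA x] by simp
    with y(1) show "?qA x \<in> (\<lambda>y. ?qA (h y)) ` carrier B" by (rule_tac image_eqI)
  qed (simp add: h.f_im)
  have eq_iff: "?qA (h y) = ?qA (h z) \<longleftrightarrow> ?qB y = ?qB z"
    if "y \<in> carrier B" "z \<in> carrier B" for y z
    using that ker[of "y \<ominus>\<^bsub>B\<^esub> z"]
    by (simp add: A.quot_mod_eq_iff[OF NA] B.quot_mod_eq_iff[OF NB])
  \<comment> \<open>The inverse of the map induced by \<open>h\<close>; the choice of \<open>y\<close> does not matter by \<open>eq_iff\<close>.\<close>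
  define \<phi> where "\<phi> X = ?qB (SOME y. y \<in> carrier B \<and> ?qA (h y) = X)" for X
  have \<phi>: "\<phi> (?qA (h y)) = ?qB y" if y: "y \<in> carrier B" for y
  proof -
    let ?z = "SOME z. z \<in> carrier B \<and> ?qA (h z) = ?qA (h y)"
    have "?z \<in> carrier B \<and> ?qA (h ?z) = ?qA (h y)"
      by (rule someI[of _ y]) (simp add: y)
    with eq_iff[of ?z y] y show ?thesis unfolding \<phi>_def by blast
  qed
  have "bij_betw \<phi> (carrier (quot_mod A NA)) (carrier (quot_mod B NB))"
    unfolding bij_betw_def
  proof
    show "inj_on \<phi> (carrier (quot_mod A NA))"
    proof (rule inj_onI)
      fix X Y
      assume "X \<in> carrier (quot_mod A NA)" "Y \<in> carrier (quot_mod A NA)" and eq: "\<phi> X = \<phi> Y"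
      then obtain y z where "y \<in> carrier B" "X = ?qA (h y)" "z \<in> carrier B" "Y = ?qA (h z)"
        unfolding qA_carrier by blast
      with eq show "X = Y" using \<phi>[of y] \<phi>[of z] eq_iff[of y z] by simp
    qed
    show "\<phi> ` carrier (quot_mod A NA) = carrier (quot_mod B NB)"
      by (simp add: qA_carrier carrier_quot_mod[of B] image_image \<phi> cong: image_cong_simp)
  qed
  moreover have "\<phi> \<in> LinearCombinations.module_hom class_ring (quot_mod A NA) (quot_mod B NB)"
    unfolding LinearCombinations.module_hom_def
  proof (intro CollectI conjI allI impI)
    show "\<phi> \<in> carrier (quot_mod A NA) \<rightarrow> carrier (quot_mod B NB)"
      by (auto simp: qA_carrier carrier_quot_mod[of B] \<phi>)
    show "\<phi> (X \<oplus>\<^bsub>quot_mod A NA\<^esub> Y) = \<phi> X \<oplus>\<^bsub>quot_mod B NB\<^esub> \<phi> Y"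
      if "X \<in> carrier (quot_mod A NA) \<and> Y \<in> carrier (quot_mod A NA)" for X Y
      using that
      by (auto simp: qA_carrier \<phi> A.quot_mod_add[OF NA] B.quot_mod_add[OF NB]
          simp flip: h.f_add)
    show "\<phi> (c \<odot>\<^bsub>quot_mod A NA\<^esub> X) = c \<odot>\<^bsub>quot_mod B NB\<^esub> \<phi> X"
      if "c \<in> carrier class_ring \<and> X \<in> carrier (quot_mod A NA)" for c X
      using that
      by (auto simp: qA_carrier \<phi> A.quot_mod_smult[OF NA] B.quot_mod_smult[OF NB]
          simp flip: h.f_smult)
  qed
  ultimately show ?thesis unfolding Z_module_iso_def by blast
qed

subsection \<open>The two modules\<close>

lemma cring_class_ring_int: "cring (class_ring :: int ring)"
proof (intro cringI abelian_groupI comm_monoidI)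
  show "\<exists>y\<in>carrier class_ring. y \<oplus>\<^bsub>class_ring\<^esub> x = \<zero>\<^bsub>class_ring\<^esub>"
    for x :: int by (auto intro: exI[of _ "- x"])
qed (auto simp: algebra_simps)

lemma abelian_group_poly_alg: "abelian_group (poly_alg :: (int, 'n::finite int_mpoly) module)"
proof (rule abelian_groupI)
  show "\<exists>g\<in>carrier poly_alg. g \<oplus>\<^bsub>poly_alg\<^esub> f = \<zero>\<^bsub>poly_alg\<^esub>" for f :: "'n int_mpoly"
    by (auto simp: poly_alg_def intro: exI[of _ "- f"])
qed (auto simp: poly_alg_def)

lemma module_poly_alg: "Module.module class_ring (poly_alg :: (int, 'n::finite int_mpoly) module)"
  by (rule moduleI[OF cring_class_ring_int abelian_group_poly_alg])
    (auto simp: poly_alg_def algebra_simps)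

lemma a_minus_poly_alg: "(f :: 'n::finite int_mpoly) \<ominus>\<^bsub>poly_alg\<^esub> g = f - g"
proof -
  interpret abelian_group "poly_alg :: (int, 'n int_mpoly) module"
    by (rule abelian_group_poly_alg)
  have "\<ominus>\<^bsub>poly_alg\<^esub> g = - g"
    by (rule minus_equality) (auto simp: poly_alg_def)
  then show ?thesis by (simp add: a_minus_def poly_alg_def)
qed

lemma ideal_submodule:
  assumes "ideal I poly_alg"
  shows "LinearCombinations.submodule class_ring I poly_alg"
  by (rule LinearCombinations.submodule.intro[OF module_poly_alg])
    (auto simp: poly_alg_def intro: ideal_zero[OF assms] ideal_add[OF assms] ideal_mult[OF assms])

lemma module_vec_int: "Module.module class_ring (module_vec TYPE(int) n)"
proof (rule moduleI[OF cring_class_ring_int])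
  show "abelian_group (module_vec TYPE(int) n)"
  proof (rule abelian_groupI)
    show "\<exists>w\<in>carrier (module_vec TYPE(int) n). w \<oplus>\<^bsub>module_vec TYPE(int) n\<^esub> v = \<zero>\<^bsub>module_vec TYPE(int) n\<^esub>"
      if "v \<in> carrier (module_vec TYPE(int) n)" for v
      using that add_inv_exists_vec[of v n] by (auto simp: module_vec_simps)
  qed (auto simp: module_vec_simps comm_add_vec)
qed (auto simp: module_vec_simps add_smult_distrib_vec smult_add_distrib_vec)

section \<open>Finiteness of the standard terms\<close>

lemma finite_Z_algebra_generators:
  fixes I :: "'n::finite int_mpoly set"
  assumes I: "ideal I poly_alg" and fin: "finite_Z_algebra (quot_mod poly_alg I)"
  obtains m :: nat and g :: "nat \<Rightarrow> 'n int_mpoly"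
  where "\<And>f. \<exists>c :: nat \<Rightarrow> int. f - (\<Sum>j<m. of_int (c j) * g j) \<in> I"
proof -
  let ?P = "poly_alg :: (int, 'n int_mpoly) module"
  let ?M = "quot_mod ?P I"
  let ?q = "\<lambda>f. I +>\<^bsub>?P\<^esub> f"
  interpret P: Module.module class_ring ?P by (rule module_poly_alg)
  have NI: "LinearCombinations.submodule class_ring I ?P" by (rule ideal_submodule[OF I])
  interpret Q: Module.module class_ring ?M
    using fin by (simp add: finite_Z_algebra_def algebra.module)
  obtain S where S: "finite S" "S \<subseteq> carrier ?M" "Q.span S = carrier ?M"
    using fin by (auto simp: finite_Z_algebra_def)
  have UP: "carrier ?P = UNIV" by (simp add: poly_alg_def)
  have q_carrier: "carrier ?M = range ?q"
    by (simp add: carrier_quot_mod UP)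
  have q_add: "?q f \<oplus>\<^bsub>?M\<^esub> ?q g = ?q (f + g)" for f g
    using P.quot_mod_add[OF NI, of f g] by (simp add: poly_alg_def)
  have q_smult: "c \<odot>\<^bsub>?M\<^esub> ?q f = ?q (of_int c * f)" for c f
    using P.quot_mod_smult[OF NI, of c f] by (simp add: poly_alg_def)
  have q_zero: "\<zero>\<^bsub>?M\<^esub> = ?q 0"
    by (simp add: quot_mod_def a_r_coset_def' poly_alg_def)
  define rep where "rep X = (SOME f. ?q f = X)" for X
  have rep: "?q (rep X) = X" if "X \<in> carrier ?M" for X
    using that unfolding rep_def q_carrier by (metis (mono_tags, lifting) imageE someI)
  have lincomb: "Q.lincomb a T = ?q (\<Sum>X\<in>T. of_int (a X) * rep X)" if "finite T" "T \<subseteq> S" for a T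
    using that
  proof (induction T)
    case empty
    show ?case by (simp add: Q.lincomb_def q_zero)
  next
    case (insert X T)
    have "Q.lincomb a (insert X T) = a X \<odot>\<^bsub>?M\<^esub> X \<oplus>\<^bsub>?M\<^esub> Q.lincomb a T"
      using insert.hyps insert.prems S(2) Q.lincomb_insert[of T a X] by auto
    also have "a X \<odot>\<^bsub>?M\<^esub> X = ?q (of_int (a X) * rep X)"
      using q_smult[of "a X" "rep X"] rep insert.prems S(2) by auto
    finally show ?case
      using insert by (simp add: q_add)
  qed
  obtain e where e: "bij_betw e {..<card S} S"
    using ex_bij_betw_nat_finite[OF S(1)] by (auto simp: atLeast0LessThan)
  show ?thesis
  proof (rule that)
    fix f
    have "?q f \<in> Q.span S" unfolding S(3) q_carrier by blast
    then obtain a where "Q.lincomb a S = ?q f"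
      using Q.finite_in_span[OF S(1,2)] by blast
    then have "?q f = ?q (\<Sum>X\<in>S. of_int (a X) * rep X)"
      using lincomb[OF S(1)] by simp
    then have "f - (\<Sum>X\<in>S. of_int (a X) * rep X) \<in> I"
      using P.quot_mod_eq_iff[OF NI] by (simp add: UP a_minus_poly_alg)
    then have "f - (\<Sum>j<card S. of_int (a (e j)) * rep (e j)) \<in> I"
      using sum.reindex_bij_betw[OF e, of "\<lambda>X. of_int (a X) * rep X"] by simp
    then show "\<exists>c. f - (\<Sum>j<card S. of_int (c j) * rep (e j)) \<in> I"
      by (intro exI[of _ "\<lambda>j. a (e j)"])
  qed
qed

text \<open>The determinant trick: multiplication by \<open>x\<close> acts on the generators \<open>g\<close> of \<open>P/I\<close> through an integer
  matrix \<open>A\<close>, so \<open>x - A\<close> kills them modulo \<open>I\<close>. Multiplying by the adjugate, \<open>det (x - A)\<close> kills all of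
  \<open>P/I\<close>, in particular the class of 1, and this determinant is the characteristic polynomial of \<open>A\<close>
  evaluated at \<open>x\<close>.\<close>

lemma monic_poly_in_ideal:
  fixes I :: "'n::finite int_mpoly set" and g :: "nat \<Rightarrow> 'n int_mpoly"
  assumes I: "ideal I poly_alg"
    and gen: "\<And>f. \<exists>c :: nat \<Rightarrow> int. f - (\<Sum>j<m. of_int (c j) * g j) \<in> I"
  obtains p :: "int poly" where "lead_coeff p = 1" "poly (map_poly of_int p) x \<in> I"
proof -
  obtain c :: "nat \<Rightarrow> nat \<Rightarrow> int"
    where c: "\<And>i. x * g i - (\<Sum>j<m. of_int (c i j) * g j) \<in> I"
    using gen[of "x * g _"] by metis
  obtain d :: "nat \<Rightarrow> int" where d: "1 - (\<Sum>j<m. of_int (d j) * g j) \<in> I"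
    using gen by metis
  define A where "A = mat m m (\<lambda>(i, j). c i j)"
  \<comment> \<open>The matrix \<open>x - A\<close> over the polynomial ring.\<close>
  define B where "B = mat m m (\<lambda>(i, j). (if i = j then x else 0) - of_int (c i j))"
  have A: "A \<in> carrier_mat m m" and B: "B \<in> carrier_mat m m"
    by (simp_all add: A_def B_def)
  have "poly (map_poly of_int (char_poly A)) x = det B"
    unfolding of_int_hom.char_poly_hom[OF A, symmetric] unfolding char_poly_def
    by (rule poly_det_cong[OF B])
      (auto simp: char_poly_matrix_def A_def B_def)
  moreover have "det B * g i \<in> I" if i: "i < m" for i
  proof -
    let ?C = "adj_mat B"
    have entry: "(\<Sum>j<m. ?C $$ (i, j) * B $$ (j, k)) = (if i = k then det B else 0)" if "k < m" for k
    proof -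
      have "(?C * B) $$ (i, k) = (\<Sum>j<m. ?C $$ (i, j) * B $$ (j, k))"
        using i that B adj_mat(1)[OF B]
        by (auto simp: times_mat_def scalar_prod_def atLeast0LessThan intro!: sum.cong)
      then show ?thesis
        using i that by (auto simp: adj_mat(3)[OF B])
    qed
    have "det B * g i = (\<Sum>k<m. (if i = k then det B else 0) * g k)"
      using i by (simp add: if_distrib[of "\<lambda>y. y * _"] cong: if_cong)
    also have "\<dots> = (\<Sum>k<m. (\<Sum>j<m. ?C $$ (i, j) * B $$ (j, k)) * g k)"
      by (rule sum.cong) (simp_all add: entry)
    also have "\<dots> = (\<Sum>k<m. \<Sum>j<m. ?C $$ (i, j) * (B $$ (j, k) * g k))"
      by (simp add: sum_distrib_right mult.assoc)
    also have "\<dots> = (\<Sum>j<m. ?C $$ (i, j) * (\<Sum>k<m. B $$ (j, k) * g k))"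
      by (subst sum.swap) (simp add: sum_distrib_left)
    also have "\<dots> \<in> I"
    proof (rule ideal_sum[OF I], rule ideal_mult[OF I])
      fix j assume "j \<in> {..<m}"
      then have "(\<Sum>k<m. B $$ (j, k) * g k) =
          (\<Sum>k<m. (if j = k then x * g k else 0) - of_int (c j k) * g k)"
        by (intro sum.cong) (auto simp: B_def algebra_simps)
      also have "\<dots> = x * g j - (\<Sum>k<m. of_int (c j k) * g k)"
        using \<open>j \<in> {..<m}\<close> by (simp add: sum_subtractf)
      finally show "(\<Sum>k<m. B $$ (j, k) * g k) \<in> I" using c by simp
    qed
    finally show ?thesis .
  qed
  then have "(\<Sum>j<m. of_int (d j) * (det B * g j)) \<in> I"
    by - (rule ideal_sum[OF I], rule ideal_mult[OF I], simp)
  from ideal_add[OF I ideal_mult[OF I d, of "det B"] this]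
  have "det B \<in> I"
    by (simp add: right_diff_distrib sum_distrib_left mult.left_commute)
  ultimately show ?thesis
    using degree_monic_char_poly[OF A] by (intro that[of "char_poly A"]) auto
qed

lemma poly_at_indeterminate:
  "poly (map_poly of_int p) (Poly_Mapping.single (Poly_Mapping.single x 1) 1 :: 'n int_mpoly) =
    (\<Sum>i\<le>degree p. Poly_Mapping.single (Poly_Mapping.single x i) (coeff p i))"
proof -
  have power: "(Poly_Mapping.single (Poly_Mapping.single x 1) 1 :: 'n int_mpoly) ^ i =
      Poly_Mapping.single (Poly_Mapping.single x i) 1" for i
    by (induction i) (simp_all add: mult_single flip: single_add)
  have of_int: "(of_int c :: 'n int_mpoly) * Poly_Mapping.single t 1 = Poly_Mapping.single t c" for c t
    using mult_single[of 0 c t 1] by (simp flip: single_of_int)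
  have "degree (map_poly (of_int :: int \<Rightarrow> 'n int_mpoly) p) = degree p"
    by (rule degree_map_poly) simp
  then show ?thesis
    unfolding poly_altdef by (simp add: coeff_map_poly power of_int del: One_nat_def)
qed

context monomial_order
begin

text \<open>The higher of two powers of one indeterminate is the greater one in every term ordering, so a
  monic integer polynomial in \<open>x\<close> has leading coefficient 1 with respect to \<open>\<sigma>\<close> too.\<close>

lemma monic_pure_power_in_ideal:
  assumes "ideal I poly_alg" "finite_Z_algebra (quot_mod poly_alg I)"
  shows "\<exists>d. \<exists>f\<in>I. f \<noteq> 0 \<and> LT \<sigma> f = Poly_Mapping.single x d \<and> LC \<sigma> f = 1"
proof -
  obtain m g where gen: "\<And>f. \<exists>c :: nat \<Rightarrow> int. f - (\<Sum>j<m. of_int (c j) * g j) \<in> I"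
    using finite_Z_algebra_generators[OF assms] by blast
  obtain p :: "int poly" where p: "lead_coeff p = 1"
    "poly (map_poly of_int p) (Poly_Mapping.single (Poly_Mapping.single x 1) 1) \<in> I"
    by (rule monic_poly_in_ideal[OF assms(1) gen])
  define f where "f = (\<Sum>i\<le>degree p. Poly_Mapping.single (Poly_Mapping.single x i) (coeff p i))"
  have "Poly_Mapping.single x i = Poly_Mapping.single x j \<longleftrightarrow> i = j" for i j :: nat
    by (rule inj_eq[OF inj_single])
  then have lead: "Poly_Mapping.lookup f (Poly_Mapping.single x (degree p)) = 1"
    using p(1) by (simp add: f_def lookup_sum lookup_single when_def)
  have below: "s \<preceq> Poly_Mapping.single x (degree p)" if "s \<in> Poly_Mapping.keys f" for s
  proof -
    from that obtain i where i: "i \<le> degree p" "s = Poly_Mapping.single x i"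
      using Poly_Mapping.keys_sum[of "\<lambda>i. Poly_Mapping.single (Poly_Mapping.single x i) (coeff p i)"
          "{..degree p}"]
      by (auto simp: f_def split: if_splits)
    then have "Poly_Mapping.single x (degree p) = s + Poly_Mapping.single x (degree p - i)"
      by (simp flip: single_add)
    then show ?thesis using le_add by metis
  qed
  have "LT \<sigma> f = Poly_Mapping.single x (degree p)"
    using lead below by (intro LT_eqI) (auto simp: in_keys_iff)
  moreover have "f \<in> I" using p(2) by (simp only: poly_at_indeterminate f_def)
  moreover have "f \<noteq> 0" using lead by auto
  ultimately show ?thesis using lead unfolding LC_def by metis
qed

text \<open>A term divisible by a pure power from the previous lemma is itself a leading monomial of \<open>I\<close>. Hence
  the exponent of each indeterminate in a standard term is bounded.\<close>

lemma finite_standard_terms: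
  assumes I: "ideal I poly_alg" and "finite_Z_algebra (quot_mod poly_alg I)"
  shows "finite (standard_terms \<sigma> I)"
proof -
  obtain d where d: "\<And>x. \<exists>f\<in>I. f \<noteq> 0 \<and> LT \<sigma> f = Poly_Mapping.single x (d x) \<and> LC \<sigma> f = 1"
    using monic_pure_power_in_ideal[OF assms] by metis
  have "Poly_Mapping.lookup t x < d x" if "t \<in> standard_terms \<sigma> I" for t x
  proof (rule ccontr)
    assume "\<not> Poly_Mapping.lookup t x < d x"
    then have t: "t = (t - Poly_Mapping.single x (d x)) + Poly_Mapping.single x (d x)" (is "_ = ?u + _")
      by (intro poly_mapping_eqI) (auto simp: lookup_add lookup_minus lookup_single when_def)
    obtain f where f: "f \<in> I" "f \<noteq> 0" "LT \<sigma> f = Poly_Mapping.single x (d x)" "LC \<sigma> f = 1"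
      using d by blast
    let ?h = "Poly_Mapping.single ?u 1 * f"
    have "LT \<sigma> ?h = t" "LC \<sigma> ?h = 1"
      using f t LT_single_mult[OF f(2), of 1 ?u] LC_single_mult[OF f(2), of 1 ?u] by auto
    moreover have "?h \<noteq> 0" using keys_single_mult[of 1 ?u f] f(2) by auto
    moreover have "?h \<in> I" by (rule ideal_mult[OF I f(1)])
    ultimately show False using that by (auto simp: standard_terms_iff)
  qed
  then have "Poly_Mapping.lookup ` standard_terms \<sigma> I \<subseteq> PiE UNIV (\<lambda>x. {..<d x})"
    by auto
  then have "finite (Poly_Mapping.lookup ` standard_terms \<sigma> I)"
    by (rule finite_subset) (rule finite_PiE, simp_all)
  then show ?thesis
    by (rule finite_imageD) (rule inj_onI, rule poly_mapping_eqI, simp)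
qed

end

section \<open>Coefficient vectors\<close>

definition poly_of_vec :: "'n::finite pp list \<Rightarrow> int vec \<Rightarrow> 'n int_mpoly" where
  "poly_of_vec ts c = (\<Sum>i<length ts. Poly_Mapping.single (ts ! i) (c $ i))"

lemma coeff_vec_of_iff:
  "coeff_vec_of ts f c \<longleftrightarrow> c \<in> carrier_vec (length ts) \<and> f = poly_of_vec ts c"
  by (simp add: coeff_vec_of_def poly_of_vec_def)

lemma lookup_poly_of_vec:
  assumes "distinct ts" "i < length ts"
  shows "Poly_Mapping.lookup (poly_of_vec ts c) (ts ! i) = c $ i"
  using assms
  by (simp add: poly_of_vec_def lookup_sum lookup_single when_def nth_eq_iff_index_eq)

lemma keys_poly_of_vec: "Poly_Mapping.keys (poly_of_vec ts c) \<subseteq> set ts"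
proof
  fix s assume "s \<in> Poly_Mapping.keys (poly_of_vec ts c)"
  then obtain i where "i < length ts" "s \<in> Poly_Mapping.keys (Poly_Mapping.single (ts ! i) (c $ i))"
    using Poly_Mapping.keys_sum[of "\<lambda>i. Poly_Mapping.single (ts ! i) (c $ i)" "{..<length ts}"]
    unfolding poly_of_vec_def by blast
  then show "s \<in> set ts" by (simp split: if_splits)
qed

lemma poly_of_vec_lookup:
  assumes "distinct ts" "Poly_Mapping.keys f \<subseteq> set ts"
  shows "poly_of_vec ts (vec (length ts) (\<lambda>i. Poly_Mapping.lookup f (ts ! i))) = f" (is "?g = f")
proof (rule poly_mapping_eqI)
  fix s
  show "Poly_Mapping.lookup ?g s = Poly_Mapping.lookup f s"
  proof (cases "s \<in> set ts")
    case True
    then obtain i where "i < length ts" "s = ts ! i" by (metis in_set_conv_nth)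
    with assms(1) show ?thesis by (simp add: lookup_poly_of_vec)
  next
    case False
    then have "s \<notin> Poly_Mapping.keys ?g" "s \<notin> Poly_Mapping.keys f"
      using keys_poly_of_vec assms(2) by blast+
    then show ?thesis by (simp add: in_keys_iff)
  qed
qed

lemma coeff_vec_of_exists:
  assumes "distinct ts" "Poly_Mapping.keys f \<subseteq> set ts"
  shows "\<exists>c. coeff_vec_of ts f c"
  unfolding coeff_vec_of_iff using poly_of_vec_lookup[OF assms] by (metis vec_carrier)

lemma poly_of_vec_eq_0D:
  assumes "distinct ts" "c \<in> carrier_vec (length ts)" "poly_of_vec ts c = 0"
  shows "c = 0\<^sub>v (length ts)"
  using assms(2) lookup_poly_of_vec[OF assms(1), of _ c] unfolding assms(3)
  by (intro eq_vecI) auto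

lemma poly_of_vec_add:
  assumes "c \<in> carrier_vec (length ts)" "d \<in> carrier_vec (length ts)"
  shows "poly_of_vec ts (c + d) = poly_of_vec ts c + poly_of_vec ts d"
  using assms by (simp add: poly_of_vec_def single_add sum.distrib)

lemma poly_of_vec_diff:
  assumes "c \<in> carrier_vec (length ts)" "d \<in> carrier_vec (length ts)"
  shows "poly_of_vec ts (c - d) = poly_of_vec ts c - poly_of_vec ts d"
  using assms by (simp add: poly_of_vec_def single_diff sum_subtractf)

lemma poly_of_vec_smult:
  assumes "c \<in> carrier_vec (length ts)"
  shows "poly_of_vec ts (a \<cdot>\<^sub>v c) = of_int a * poly_of_vec ts c"
proof -
  have "of_int a * Poly_Mapping.single t b = Poly_Mapping.single t (a * b)" for b :: int and t :: "'a pp"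
    using mult_single[of 0 a t b] by (simp flip: single_of_int)
  with assms show ?thesis by (simp add: poly_of_vec_def sum_distrib_left)
qed

lemma poly_of_vec_hom:
  "poly_of_vec ts \<in>
    LinearCombinations.module_hom class_ring (module_vec TYPE(int) (length ts)) poly_alg"
  by (auto simp: LinearCombinations.module_hom_def module_vec_simps poly_alg_def
      poly_of_vec_add poly_of_vec_smult)

text \<open>The vectors that steps (3) and (4) may append for the term \<open>t\<close>. There can be several, since the
  remainder of the Division Algorithm is not unique.\<close>

definition relation_at ::
  "'n::finite pp rel \<Rightarrow> 'n int_mpoly set \<Rightarrow> 'n pp list \<Rightarrow> 'n pp \<Rightarrow> int vec \<Rightarrow> bool" where
  "relation_at \<sigma> G ts t u \<longleftrightarrow> (\<exists>l c r d. step3_cand \<sigma> G t l \<and> (\<forall>l'. step3_cand \<sigma> G t l' \<longrightarrow> l \<le> l') \<and>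
     coeff_vec_of ts (Poly_Mapping.single t l) c \<and> normal_form \<sigma> G (Poly_Mapping.single t l) r \<and>
     coeff_vec_of ts r d \<and> u = c - d)"

section \<open>The relations among the standard terms\<close>

lemma least_step3_cand:
  assumes "step3_cand \<sigma> G t l"
  obtains l where "step3_cand \<sigma> G t l" "\<And>l'. step3_cand \<sigma> G t l' \<Longrightarrow> l \<le> l'"
proof -
  obtain l where l: "step3_cand \<sigma> G t l" "\<And>l'. step3_cand \<sigma> G t l' \<Longrightarrow> nat l \<le> nat l'"
    using ex_has_least_nat[of "step3_cand \<sigma> G t", OF assms, of nat] by blast
  have "l \<le> l'" if "step3_cand \<sigma> G t l'" for l'
    using l(2)[OF that] that l(1) by (auto simp: step3_cand_def nat_le_eq_zle)
  with l(1) show ?thesis by (rule that)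
qed

context strong_groebner_basis
begin

lemma step3_candE:
  assumes "step3_cand \<sigma> G t l"
  obtains g u where "g \<in> G" "t = u + LT \<sigma> g" "LC \<sigma> g = l" "l > 1"
  using assms by (auto simp: step3_cand_def LM_in_LM_set_iff)

text \<open>A basis element whose leading monomial divides that of \<open>f\<close> provides the candidate: its leading
  coefficient is positive by assumption, and it is not 1 because otherwise the term \<open>LT \<sigma> f\<close> would
  be a leading monomial of \<open>I\<close>.\<close>

lemma step3_cand_dvd_LC:
  assumes pos: "\<And>g. g \<in> G \<Longrightarrow> LC \<sigma> g > 0"
    and f: "f \<in> I" "f \<noteq> 0" "LT \<sigma> f \<in> standard_terms \<sigma> I"
  shows "\<exists>l. step3_cand \<sigma> G (LT \<sigma> f) l \<and> l dvd LC \<sigma> f"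
proof -
  obtain g u a where g: "g \<in> G" "LT \<sigma> f = u + LT \<sigma> g" "LC \<sigma> f = a * LC \<sigma> g"
    using f(1,2) by (rule ideal_LME)
  have "g \<noteq> 0" using G_nonzero g(1) .
  have "LC \<sigma> g \<noteq> 1"
  proof
    assume "LC \<sigma> g = 1"
    then have "LT \<sigma> (Poly_Mapping.single u 1 * g) = LT \<sigma> f"
      "LC \<sigma> (Poly_Mapping.single u 1 * g) = 1"
      using \<open>g \<noteq> 0\<close> g(2) by (simp_all add: LT_single_mult LC_single_mult)
    moreover have "Poly_Mapping.single u 1 * g \<noteq> 0"
      using keys_single_mult[of 1 u g] \<open>g \<noteq> 0\<close> by auto
    moreover have "Poly_Mapping.single u 1 * g \<in> I"
      using G_subset g(1) by (intro ideal_mult[OF ideal])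
    ultimately show False using f(3) by (auto simp: standard_terms_iff)
  qed
  with pos[OF g(1)] have "LC \<sigma> g > 1" by simp
  then have "step3_cand \<sigma> G (LT \<sigma> f) (LC \<sigma> g)"
    using g(1,2) \<open>g \<noteq> 0\<close> by (auto simp: step3_cand_def LM_in_LM_set_iff)
  with g(3) show ?thesis by auto
qed

text \<open>The leading coefficients of the elements of \<open>I\<close> with leading term \<open>t\<close> form, together with 0, an ideal
  of the integers, and the smallest candidate generates it. By Bezout's identity, \<open>gcd l m\<close> is the
  leading coefficient of some combination \<open>f\<close> of the basis elements belonging to \<open>l\<close> and \<open>m\<close>; a
  candidate that divides \<open>gcd l m\<close> cannot be smaller than \<open>l\<close>, so \<open>gcd l m = l\<close>.\<close>

lemma least_step3_cand_dvd:
  assumes pos: "\<And>g. g \<in> G \<Longrightarrow> LC \<sigma> g > 0"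
    and t: "t \<in> standard_terms \<sigma> I"
    and l: "step3_cand \<sigma> G t l" "\<And>l'. step3_cand \<sigma> G t l' \<Longrightarrow> l \<le> l'"
    and m: "step3_cand \<sigma> G t m"
  shows "l dvd m"
proof -
  obtain g u where g: "g \<in> G" "t = u + LT \<sigma> g" "LC \<sigma> g = l" "l > 1"
    using l(1) by (rule step3_candE)
  obtain h w where h: "h \<in> G" "t = w + LT \<sigma> h" "LC \<sigma> h = m" "m > 1"
    using m by (rule step3_candE)
  obtain x y where xy: "x * l + y * m = gcd l m" using bezout_int by blast
  define f where "f = Poly_Mapping.single u x * g + Poly_Mapping.single w y * h"
  have "f \<in> I"
    unfolding f_def using g(1) h(1) G_subset
    by (intro ideal_add[OF ideal] ideal_mult[OF ideal])
  have "Poly_Mapping.lookup f t = gcd l m"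
    using lookup_single_mult[of u x g "LT \<sigma> g"] lookup_single_mult[of w y h "LT \<sigma> h"] g h xy
    by (simp add: f_def lookup_add LC_def)
  moreover have "gcd l m > 0" using g(4) by simp
  ultimately have t_key: "t \<in> Poly_Mapping.keys f" by (simp add: in_keys_iff)
  have single_mult_below: "s \<preceq> v + LT \<sigma> p"
    if "s \<in> Poly_Mapping.keys (Poly_Mapping.single v z * p)" for s v z p
    using that keys_single_mult[of z v p] LT_max[of _ p] add_le_mono
    by (cases "z = 0") auto
  have LT: "LT \<sigma> f = t"
  proof (rule LT_eqI[OF t_key])
    fix s assume "s \<in> Poly_Mapping.keys f"
    then have "s \<in> Poly_Mapping.keys (Poly_Mapping.single u x * g) \<or>
        s \<in> Poly_Mapping.keys (Poly_Mapping.single w y * h)"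
      unfolding f_def
      using keys_add[of "Poly_Mapping.single u x * g" "Poly_Mapping.single w y * h"] by blast
    then show "s \<preceq> t"
      using single_mult_below[of s u x g] single_mult_below[of s w y h] g(2) h(2) by auto
  qed
  have "LC \<sigma> f = gcd l m"
    using LT \<open>Poly_Mapping.lookup f t = gcd l m\<close> by (simp add: LC_def)
  moreover have "f \<noteq> 0" using t_key by auto
  ultimately obtain k where k: "step3_cand \<sigma> G t k" "k dvd gcd l m"
    using step3_cand_dvd_LC[OF pos \<open>f \<in> I\<close>] LT t by auto
  have "l \<le> gcd l m"
    using l(2)[OF k(1)] zdvd_imp_le[OF k(2) \<open>gcd l m > 0\<close>] by simp
  moreover have "gcd l m \<le> l" using g(4) by (intro zdvd_imp_le) auto
  ultimately have "gcd l m = l" by simp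
  then show ?thesis by (metis gcd_dvd2)
qed

lemma relation_atE:
  assumes "relation_at \<sigma> G ts t u"
  obtains l r where "u \<in> carrier_vec (length ts)" "poly_of_vec ts u \<in> I"
    "poly_of_vec ts u = Poly_Mapping.single t l - r"
    "step3_cand \<sigma> G t l" "\<And>l'. step3_cand \<sigma> G t l' \<Longrightarrow> l \<le> l'"
    "\<And>s. s \<in> Poly_Mapping.keys r \<Longrightarrow> s \<prec> t"
proof -
  obtain l c r d where l: "step3_cand \<sigma> G t l" "\<And>l'. step3_cand \<sigma> G t l' \<Longrightarrow> l \<le> l'"
    and c: "coeff_vec_of ts (Poly_Mapping.single t l) c"
    and r: "normal_form \<sigma> G (Poly_Mapping.single t l) r"
    and d: "coeff_vec_of ts r d" and u: "u = c - d"
    using assms by (auto simp: relation_at_def)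
  have poly: "poly_of_vec ts u = Poly_Mapping.single t l - r"
    using c d by (simp add: u coeff_vec_of_iff poly_of_vec_diff)
  show ?thesis
  proof (rule that[OF _ _ poly l])
    show "u \<in> carrier_vec (length ts)" using c d by (simp add: u coeff_vec_of_iff)
    show "poly_of_vec ts u \<in> I" unfolding poly using r by (rule normal_form_cong)
    obtain g w where g: "g \<in> G" "t = w + LT \<sigma> g" "LC \<sigma> g = l" "l > 1"
      using l(1) by (rule step3_candE)
    then have "LM \<sigma> (Poly_Mapping.single t l) = Poly_Mapping.single w 1 * LM \<sigma> g"
      by (simp add: LM_def[of \<sigma> g] mult_single)
    then have "LM \<sigma> g dvd LM \<sigma> (Poly_Mapping.single t l)" by simp
    moreover have "Poly_Mapping.single t l \<noteq> 0" using g(4)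
      by (metis lookup_single_eq lookup_zero not_one_less_zero)
    ultimately show "s \<prec> t" if "s \<in> Poly_Mapping.keys r" for s
      using normal_form_reducible_below[OF r g(1) _ _ that] g(4) by simp
  qed
qed

lemma
  assumes "relation_at \<sigma> G ts t u"
  shows relation_at_carrier: "u \<in> carrier_vec (length ts)"
    and relation_at_ideal: "poly_of_vec ts u \<in> I"
  using assms by (blast elim: relation_atE)+

text \<open>An element \<open>f\<close> of \<open>I\<close> supported on standard terms is reduced to 0 by the relations: its leading
  coefficient is a multiple \<open>l k\<close> of the smallest candidate \<open>l\<close> at \<open>t = LT \<sigma> f\<close>, so subtracting \<open>k\<close>
  times the relation \<open>l t - NF(l t)\<close> cancels the leading term and introduces only smaller terms, again
  standard ones.\<close>

lemma kernel_subset_span: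
  assumes pos: "\<And>g. g \<in> G \<Longrightarrow> LC \<sigma> g > 0"
    and ts: "distinct ts" "set ts = standard_terms \<sigma> I"
    and N: "LinearCombinations.submodule class_ring N (module_vec TYPE(int) (length ts))"
    and rel: "\<And>t l. t \<in> set ts \<Longrightarrow> step3_cand \<sigma> G t l \<Longrightarrow> \<exists>u\<in>N. relation_at \<sigma> G ts t u"
    and c: "c \<in> carrier_vec (length ts)" "poly_of_vec ts c \<in> I"
  shows "c \<in> N"
proof -
  interpret N: LinearCombinations.submodule class_ring N "module_vec TYPE(int) (length ts)" by (rule N)
  have zero: "c \<in> N" if "c \<in> carrier_vec (length ts)" "poly_of_vec ts c = 0" for c
    using N.zero_closed poly_of_vec_eq_0D[OF ts(1) that] by (simp add: module_vec_simps)
  have nonzero: "c \<in> N" if "poly_of_vec ts c \<noteq> 0" "LT \<sigma> (poly_of_vec ts c) = t"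
    "c \<in> carrier_vec (length ts)" "poly_of_vec ts c \<in> I" for c t
    using wf_lt that
  proof (induction t arbitrary: c rule: wf_induct_rule)
    case (less t)
    let ?f = "poly_of_vec ts c"
    have "t \<in> set ts"
      using LT_in_keys[OF less.prems(1)] keys_poly_of_vec less.prems(2) by blast
    then have t: "t \<in> standard_terms \<sigma> I" by (simp add: ts)
    obtain m where m: "step3_cand \<sigma> G t m" "m dvd LC \<sigma> ?f"
      using step3_cand_dvd_LC[OF pos less.prems(4,1)] less.prems(2) t by auto
    obtain u where u: "u \<in> N" "relation_at \<sigma> G ts t u"
      using rel[OF \<open>t \<in> set ts\<close> m(1)] by blast
    obtain l r where u': "u \<in> carrier_vec (length ts)" "poly_of_vec ts u \<in> I"
      "poly_of_vec ts u = Poly_Mapping.single t l - r"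
      and l: "step3_cand \<sigma> G t l" "\<And>l'. step3_cand \<sigma> G t l' \<Longrightarrow> l \<le> l'"
      and r: "\<And>s. s \<in> Poly_Mapping.keys r \<Longrightarrow> s \<prec> t"
      using u(2) by (rule relation_atE) blast
    have "l dvd LC \<sigma> ?f"
      using least_step3_cand_dvd[OF pos t l m(1)] m(2) dvd_trans by blast
    then obtain k where k: "LC \<sigma> ?f = l * k" by (auto simp: dvd_def)
    define w where "w = c - k \<cdot>\<^sub>v u"
    have w: "w \<in> carrier_vec (length ts)" using less.prems(3) u'(1) by (simp add: w_def)
    have poly_w: "poly_of_vec ts w = ?f - of_int k * poly_of_vec ts u"
      using less.prems(3) u'(1) by (simp add: w_def poly_of_vec_diff poly_of_vec_smult)
    have lookup_w: "Poly_Mapping.lookup (poly_of_vec ts w) s =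
        Poly_Mapping.lookup ?f s - k * ((l when t = s) - Poly_Mapping.lookup r s)" for s
      using lookup_single_mult[of 0 k "poly_of_vec ts u" s]
      unfolding poly_w by (simp add: u'(3) lookup_minus lookup_single flip: single_of_int)
    have below: "s \<prec> t" if s: "s \<in> Poly_Mapping.keys (poly_of_vec ts w)" for s
    proof -
      have "Poly_Mapping.lookup r t = 0" using r[of t] by (auto simp: in_keys_iff)
      then have "s \<noteq> t"
        using s lookup_w[of t] k less.prems(2) by (auto simp: in_keys_iff LC_def)
      moreover from this s have "s \<in> Poly_Mapping.keys ?f \<or> s \<in> Poly_Mapping.keys r"
        using lookup_w[of s] by (auto simp: in_keys_iff)
      ultimately show ?thesis using LT_max[of s ?f] less.prems(2) r by auto
    qed
    have "w \<in> N"
    proof (cases "poly_of_vec ts w = 0")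
      case False
      have "poly_of_vec ts w \<in> I"
        unfolding poly_w by (intro ideal_diff[OF ideal] ideal_mult[OF ideal] less.prems u')
      with False below LT_in_keys[OF False] w less.IH show ?thesis by blast
    qed (use zero w in blast)
    moreover have "k \<cdot>\<^sub>v u \<in> N"
      using N.smult_closed[of k u] u(1) by (simp add: module_vec_simps)
    ultimately have "w + k \<cdot>\<^sub>v u \<in> N"
      using N.m_closed[of w "k \<cdot>\<^sub>v u"] by (simp add: module_vec_simps)
    moreover have "w + k \<cdot>\<^sub>v u = c"
      using less.prems(3) u'(1) by (intro eq_vecI) (auto simp: w_def)
    ultimately show ?case by simp
  qed
  show ?thesis using zero nonzero c by blast
qed

text \<open>Surjectivity comes from the Division Algorithm, the kernel from the two inclusions
  \<open>?N \<subseteq> ?K\<close> (the relations lie in \<open>I\<close>) and \<open>kernel_subset_span\<close>.\<close>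

lemma quotient_iso:
  assumes pos: "\<And>g. g \<in> G \<Longrightarrow> LC \<sigma> g > 0"
    and ts: "distinct ts" "set ts = standard_terms \<sigma> I"
    and U: "\<And>u. u \<in> U \<Longrightarrow> \<exists>t. relation_at \<sigma> G ts t u"
    and rel: "\<And>t l. t \<in> set ts \<Longrightarrow> step3_cand \<sigma> G t l \<Longrightarrow> \<exists>u\<in>U. relation_at \<sigma> G ts t u"
  shows "Z_module_iso (quot_mod poly_alg I)
    (quot_mod (module_vec TYPE(int) (length ts))
      (LinearCombinations.module.span class_ring (module_vec TYPE(int) (length ts)) U))"
proof -
  let ?V = "module_vec TYPE(int) (length ts)"
  let ?N = "LinearCombinations.module.span class_ring ?V U"
  interpret V: Module.module class_ring ?V by (rule module_vec_int)
  have "U \<subseteq> carrier ?V"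
    using U relation_at_carrier unfolding module_vec_simps by blast
  then have N: "LinearCombinations.submodule class_ring ?N ?V" and "U \<subseteq> ?N"
    by (rule V.span_is_submodule, rule V.in_own_span)
  interpret h: mod_hom class_ring ?V poly_alg "poly_of_vec ts"
    by (intro mod_hom.intro module_vec_int module_poly_alg mod_hom_axioms.intro poly_of_vec_hom)
  let ?K = "{c \<in> carrier_vec (length ts). poly_of_vec ts c \<in> I}"
  have K: "LinearCombinations.submodule class_ring ?K ?V"
    by (rule LinearCombinations.submodule.intro[OF module_vec_int])
      (use h.f0_is_0 in \<open>auto simp: module_vec_simps poly_alg_def poly_of_vec_add poly_of_vec_smult
        intro: ideal_zero[OF ideal] ideal_add[OF ideal] ideal_mult[OF ideal]\<close>)
  have "U \<subseteq> ?K" using U relation_at_carrier relation_at_ideal by blast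
  then have "?N \<subseteq> ?K" using K by (rule V.span_is_subset)
  show ?thesis
  proof (rule Z_module_iso_quotI[OF module_poly_alg module_vec_int ideal_submodule[OF ideal] N
        poly_of_vec_hom])
    fix f
    obtain r where r: "normal_form \<sigma> G f r" using normal_form_exists by blast
    then have "Poly_Mapping.keys r \<subseteq> set ts" using normal_form_standard ts(2) by simp
    then obtain c where "coeff_vec_of ts r c" using coeff_vec_of_exists[OF ts(1)] by blast
    then show "\<exists>c\<in>carrier ?V. f \<ominus>\<^bsub>poly_alg\<^esub> poly_of_vec ts c \<in> I"
      using normal_form_cong[OF r]
      by (auto simp: coeff_vec_of_iff module_vec_simps a_minus_poly_alg)
  next
    fix c assume "c \<in> carrier ?V"
    then have c: "c \<in> carrier_vec (length ts)" by (simp add: module_vec_simps)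
    have rel_N: "\<exists>u\<in>?N. relation_at \<sigma> G ts t u" if "t \<in> set ts" "step3_cand \<sigma> G t l" for t l
      using rel[OF that] \<open>U \<subseteq> ?N\<close> by blast
    show "poly_of_vec ts c \<in> I \<longleftrightarrow> c \<in> ?N"
    proof
      assume "poly_of_vec ts c \<in> I"
      then show "c \<in> ?N"
        using pos rel_N by (intro kernel_subset_span[OF _ ts N _ c])
    qed (use \<open>?N \<subseteq> ?K\<close> in blast)
  qed
qed

end

section \<open>Runs of the algorithm\<close>

context strong_groebner_basis
begin

lemma alg_step_progress:
  assumes ts: "distinct ts" "set ts = standard_terms \<sigma> I"
    and Os: "set Os \<subseteq> set ts" "Os \<noteq> []"
  shows "\<exists>st. alg_step \<sigma> G ts (Os, U) st"
proof -
  obtain t where t: "t \<in> set Os" using Os(2) by (meson hd_in_set)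
  show ?thesis
  proof (cases "\<exists>l. step3_cand \<sigma> G t l")
    case True
    then obtain l where l: "step3_cand \<sigma> G t l" "\<And>l'. step3_cand \<sigma> G t l' \<Longrightarrow> l \<le> l'"
      by (metis least_step3_cand)
    have "Poly_Mapping.keys (Poly_Mapping.single t l) \<subseteq> set ts" using t Os(1) by auto
    then obtain c where c: "coeff_vec_of ts (Poly_Mapping.single t l) c"
      using coeff_vec_of_exists[OF ts(1)] by blast
    obtain r where r: "normal_form \<sigma> G (Poly_Mapping.single t l) r"
      using normal_form_exists by blast
    then have "Poly_Mapping.keys r \<subseteq> set ts" using normal_form_standard ts(2) by simp
    then obtain d where "coeff_vec_of ts r d" using coeff_vec_of_exists[OF ts(1)] by blast
    with t l c r show ?thesis by (blast intro: alg_step.append)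
  next
    case False
    with t show ?thesis by (blast intro: alg_step.skip)
  qed
qed

end

lemma alg_step_termip: "termip (alg_step \<sigma> G ts) st"
proof (induction st rule: measure_induct_rule[of "\<lambda>st. length (fst st)"])
  case (less st)
  show ?case
  proof (rule accp.intros)
    fix st' assume "(alg_step \<sigma> G ts)\<inverse>\<inverse> st' st"
    then have "alg_step \<sigma> G ts st st'" by simp
    then have "length (fst st') < length (fst st)"
      by cases (auto simp: length_remove1 dest: length_pos_if_in_set)
    then show "termip (alg_step \<sigma> G ts) st'" by (rule less.IH)
  qed
qed

definition alg_inv :: "'n::finite pp rel \<Rightarrow> 'n int_mpoly set \<Rightarrow> 'n pp list \<Rightarrow>
    'n pp list \<times> int vec list \<Rightarrow> bool" where
  "alg_inv \<sigma> G ts st \<longleftrightarrow> distinct (fst st) \<and> set (fst st) \<subseteq> set ts \<and>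
     (\<forall>u\<in>set (snd st). \<exists>t. relation_at \<sigma> G ts t u) \<and>
     (\<forall>t\<in>set ts - set (fst st). \<forall>l. step3_cand \<sigma> G t l \<longrightarrow>
        (\<exists>u\<in>set (snd st). relation_at \<sigma> G ts t u))"

lemma alg_inv_step:
  assumes "alg_step \<sigma> G ts st st'" "alg_inv \<sigma> G ts st"
  shows "alg_inv \<sigma> G ts st'"
  using assms(1)
proof cases
  case (skip t Os U)
  then show ?thesis using assms(2) by (auto simp: alg_inv_def)
next
  case (append t Os l c r d U)
  then have "relation_at \<sigma> G ts t (c - d)" unfolding relation_at_def by blast
  with append assms(2) show ?thesis by (auto simp: alg_inv_def)
qed

lemma alg_inv_reachable:
  assumes "(alg_step \<sigma> G ts)\<^sup>*\<^sup>* (ts, []) st" "distinct ts"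
  shows "alg_inv \<sigma> G ts st"
  using assms(1)
proof (induction rule: rtranclp_induct)
  case base
  show ?case using assms(2) by (simp add: alg_inv_def)
next
  case (step st st')
  then show ?case using alg_inv_step by blast
qed

theorem mainTheorem14:
  fixes \<sigma> :: "'n::finite pp rel" and I G :: "'n int_mpoly set"
  assumes "ideal I poly_alg"
    and "finite_Z_algebra (quot_mod poly_alg I)"
    and "term_ordering \<sigma>"
    and "minimal_strong_GB \<sigma> I G"
    and "\<forall>g\<in>G. LC \<sigma> g > 0"
  shows "finite (standard_terms \<sigma> I) \<and>
    (\<forall>ts. distinct ts \<and> set ts = standard_terms \<sigma> I \<longrightarrow>
       termip (alg_step \<sigma> G ts) (ts, []) \<and>
       (\<forall>Os U. (alg_step \<sigma> G ts)\<^sup>*\<^sup>* (ts, []) (Os, U) \<and> Os \<noteq> [] \<longrightarrow>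
          (\<exists>st. alg_step \<sigma> G ts (Os, U) st)) \<and>
       (\<forall>U. (alg_step \<sigma> G ts)\<^sup>*\<^sup>* (ts, []) ([], U) \<longrightarrow>
          set U \<subseteq> carrier_vec (length ts) \<and>
          Z_module_iso (quot_mod poly_alg I)
            (quot_mod (module_vec TYPE(int) (length ts))
               (LinearCombinations.module.span class_ring
                  (module_vec TYPE(int) (length ts)) (set U)))))"
proof -
  interpret strong_groebner_basis \<sigma> I G
    using assms
    by (intro strong_groebner_basis.intro monomial_order.intro strong_groebner_basis_axioms.intro)
      (simp_all add: minimal_strong_GB_def)
  have pos: "\<And>g. g \<in> G \<Longrightarrow> LC \<sigma> g > 0" using assms(5) by blast
  show ?thesis
  proof (intro conjI allI impI; (elim conjE)?)
    show "finite (standard_terms \<sigma> I)" using assms(1,2) by (rule finite_standard_terms)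
  next
    fix ts
    show "termip (alg_step \<sigma> G ts) (ts, [])" by (rule alg_step_termip)
  next
    fix ts Os U
    assume "distinct ts" "set ts = standard_terms \<sigma> I"
      "(alg_step \<sigma> G ts)\<^sup>*\<^sup>* (ts, []) (Os, U)" "Os \<noteq> []"
    then show "\<exists>st. alg_step \<sigma> G ts (Os, U) st"
      using alg_inv_reachable[of \<sigma> G ts "(Os, U)"]
      by (intro alg_step_progress) (simp_all add: alg_inv_def)
  next
    fix ts U
    assume ts: "distinct ts" "set ts = standard_terms \<sigma> I"
      and "(alg_step \<sigma> G ts)\<^sup>*\<^sup>* (ts, []) ([], U)"
    then have "alg_inv \<sigma> G ts ([], U)" by (intro alg_inv_reachable)
    then have U: "\<And>u. u \<in> set U \<Longrightarrow> \<exists>t. relation_at \<sigma> G ts t u"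
      and rel: "\<And>t l. t \<in> set ts \<Longrightarrow> step3_cand \<sigma> G t l \<Longrightarrow> \<exists>u\<in>set U. relation_at \<sigma> G ts t u"
      by (auto simp: alg_inv_def)
    show "set U \<subseteq> carrier_vec (length ts)" using U relation_at_carrier by blast
    show "Z_module_iso (quot_mod poly_alg I)
        (quot_mod (module_vec TYPE(int) (length ts))
          (LinearCombinations.module.span class_ring (module_vec TYPE(int) (length ts)) (set U)))"
      using pos U rel by (intro quotient_iso[OF _ ts])
  qed
qed

end
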